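(* Let $G$ be a finite Abelian group, let $d\ge 1$, and let $L=(L_{11},\dots,L_{1d})\in \mathbb{Z}^{1\times d}$ be such that every coefficient $L_{1i}$ is coprime to $|G|$. \begin{enumerate} \item If $d$ is even and a canceling partition in $G$ exists for $L$, then $L$ is fully Sidorenko in $G$, i.e. $t_L(f)\ge \mathbb{E}(f)^d$ for every $f\colon G\to[0,1]$. \item If $d$ is odd, then $L$ is fully common in $G$, i.e. $t_L(f)+t_L(1-f)\ge (1/2)^{d-1}$ for every $f\colon G\to[0,1]$. \item If $d$ is odd, then $L$ is not fully Sidorenko in $G$, i.e. there exists $f\colon G\to[0,1]$ with $t_L(f)<\mathbb{E}(f)^d$. \item If $d$ is even but no canceling partition in $G$ exists for $L$, then $L$ is not fully common (and hence not fully Sidorenko) in $G$, i.e. there exists $f\colon G\to[0,1]$ with $t_L(f)+t_L(1-f)<(1/2)^{d-1}$. \end{enumerate}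
   Context: For a finite set $X$ and $f\colon X\to\mathbb{C}$, $\mathbb{E}(f)=\mathbb{E}_{x\in X}f(x)=\frac{1}{|X|}\sum_{x\in X}f(x)$. For $L\in\mathbb{Z}^{1\times d}$, the configuration $\mathcal{C}(L)=\{v\in G^d: \sum_{i=1}^d L_{1i}v_i=0\}$, and for $f\colon G\to\mathbb{R}$ the arithmetic multiplicity is $t_L(f)=\frac{1}{|\mathcal{C}(L)|}\sum_{v\in\mathcal{C}(L)}\prod_{i=1}^d f(v_i)$. A pair of integers $(m,n)$ is canceling in $G$ if $(m+n)x=0$ for all $x\in G$. A canceling partition in $G$ for $L$ is a partition of $\{1,\dots,d\}$ into pairs such that for each pair $\{i,j\}$ the pair $(L_{1i},L_{1j})$ is canceling in $G$. $L$ is fully Sidorenko in $G$ if $t_L(f)\ge\mathbb{E}(f)^d$ for all $f\colon G\to[0,1]$; $L$ is fully common in $G$ if $t_L(f)+t_L(1-f)\ge(1/2)^{d-1}$ for all $f\colon G\to[0,1]$.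
   Formalization: Part 3 is proved for |G| > 1 only: for the trivial group it is false, since C(L) is a single point and t_L(f) = f(0)^d = E(f)^d for every f, so L is fully Sidorenko there. *)

theory Defs
  imports Complex_Main "HOL-Library.FuncSet" "HOL-Library.Disjoint_Sets" "HOL-Algebra.Group"
    "HOL-Algebra.FiniteProduct" "HOL-Algebra.Coset"
begin

text \<open>
  A finite Abelian group is a \<^const>\<open>comm_group\<close> in the sense of HOL-Algebra, hence written
  multiplicatively: the integer multiple \<open>m x\<close> becomes the power \<open>x [^] m\<close>, sums in the group
  become \<^const>\<open>finprod\<close>, and \<open>0\<close> becomes \<open>\<one>\<close>. A row \<open>L \<in> \<int>\<^bsup>1\<times>d\<^esup>\<close> is given by
  its entries \<open>L i\<close> for \<open>i \<in> {1..d}\<close>; other values of \<open>L\<close> are irrelevant. Likewise, a function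
  on \<open>G\<close> is only ever evaluated on the carrier.
\<close>

definition expect :: "'a set \<Rightarrow> ('a \<Rightarrow> 'c::field_char_0) \<Rightarrow> 'c"
  where "expect X f = (\<Sum>x\<in>X. f x) / of_nat (card X)"

definition configuration ::
    "('a, 'b) monoid_scheme \<Rightarrow> nat \<Rightarrow> (nat \<Rightarrow> int) \<Rightarrow> (nat \<Rightarrow> 'a) set"
  where "configuration G d L =
    {v \<in> {1..d} \<rightarrow>\<^sub>E carrier G. finprod G (\<lambda>i. v i [^]\<^bsub>G\<^esub> L i) {1..d} = \<one>\<^bsub>G\<^esub>}"

definition arith_mult ::
    "('a, 'b) monoid_scheme \<Rightarrow> nat \<Rightarrow> (nat \<Rightarrow> int) \<Rightarrow> ('a \<Rightarrow> real) \<Rightarrow> real"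
  where "arith_mult G d L f =
    (\<Sum>v\<in>configuration G d L. \<Prod>i=1..d. f (v i)) / real (card (configuration G d L))"

definition canceling :: "('a, 'b) monoid_scheme \<Rightarrow> int \<Rightarrow> int \<Rightarrow> bool"
  where "canceling G m n \<longleftrightarrow> (\<forall>x\<in>carrier G. x [^]\<^bsub>G\<^esub> (m + n) = \<one>\<^bsub>G\<^esub>)"

definition canceling_partition ::
    "('a, 'b) monoid_scheme \<Rightarrow> nat \<Rightarrow> (nat \<Rightarrow> int) \<Rightarrow> nat set set \<Rightarrow> bool"
  where "canceling_partition G d L P \<longleftrightarrow>
    partition_on {1..d} P \<and>
    (\<forall>B\<in>P. \<exists>i j. i \<noteq> j \<and> B = {i, j} \<and> canceling G (L i) (L j))"

definition fully_Sidorenko :: "('a, 'b) monoid_scheme \<Rightarrow> nat \<Rightarrow> (nat \<Rightarrow> int) \<Rightarrow> bool"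
  where "fully_Sidorenko G d L \<longleftrightarrow>
    (\<forall>f \<in> carrier G \<rightarrow> {0..1}. arith_mult G d L f \<ge> expect (carrier G) f ^ d)"

definition fully_common :: "('a, 'b) monoid_scheme \<Rightarrow> nat \<Rightarrow> (nat \<Rightarrow> int) \<Rightarrow> bool"
  where "fully_common G d L \<longleftrightarrow>
    (\<forall>f \<in> carrier G \<rightarrow> {0..1}.
      arith_mult G d L f + arith_mult G d L (\<lambda>x. 1 - f x) \<ge> (1 / 2) ^ (d - 1))"

end

theory Submission
  imports Defs "HOL-Algebra.Multiplicative_Group" "HOL-Computational_Algebra.Primes"
begin

text \<open>
  Any \<open>d - 1\<close> coordinates of a uniformly random point of the configuration are independent, so
  \<open>t(a + g) = a\<^sup>d + t(g)\<close> for a constant \<open>a\<close> and \<open>g\<close> of mean zero. For odd \<open>d\<close> the deviations of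
  \<open>f\<close> and \<open>1 - f\<close> from their means cancel, which gives commonness; as the indicator of the unit
  exceeds its Sidorenko bound strictly, its complement violates it. A canceling partition turns
  the sum over the configuration into a sum of squares, to which Cauchy-Schwarz applies.

  For even \<open>d\<close> without a canceling partition it remains to find \<open>g\<close> of mean zero with \<open>t(g) < 0\<close>.
  Take \<open>x\<close> whose order \<open>e\<close> is the exponent of the group and \<open>g\<close> supported on the powers of \<open>x\<close>,
  \<open>g(x\<^sup>n) = \<Sum>\<^sub>k exp(2\<pi>ikn/e + i\<theta>w(k))\<close>, the sum being over the residues \<open>k\<close> coprime to \<open>e\<close>.
  Then \<open>t(g)\<close> is a positive multiple of \<open>\<Sum>\<^sub>c exp(i\<theta> \<Sum>\<^sub>j w(c L\<^sub>j))\<close>. It is positive at \<open>\<theta> = 0\<close>,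
  and if \<open>w\<close> is generic, all the frequencies are nonzero because there is no canceling partition;
  so the average over \<open>\<theta>\<close> is zero and some value is negative.
\<close>

section \<open>Elements whose order is the exponent of the group\<close>

text \<open>If \<open>(a \<otimes> b) [^] k = \<one>\<close>, raising to the power
  \<open>ord b\<close> eliminates \<open>b\<close>, so \<open>ord a\<close> divides
  \<open>k * ord b\<close> and by coprimality \<open>k\<close>. With
  \<open>k = ord (x \<otimes> y)\<close> and both choices of roles, each of the two orders divides
  that of the product.\<close>

lemma (in comm_group) ord_mult_coprime:
  assumes "x \<in> carrier G" "y \<in> carrier G" "coprime (ord x) (ord y)"
  shows "ord (x \<otimes> y) = ord x * ord y"
proof (rule dvd_antisym)
  show "ord (x \<otimes> y) dvd ord x * ord y"
    using assms by (simp add: abelian_ord_mul_divides)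
  have *: "ord a dvd k" if "a \<in> carrier G" "b \<in> carrier G" "coprime (ord a) (ord b)"
    "(a \<otimes> b) [^] k = \<one>" for a b and k :: nat
  proof -
    have "b [^] (k * ord b) = \<one>"
      using that by (simp add: pow_eq_id)
    then have "a [^] (k * ord b) = (a \<otimes> b) [^] (k * ord b)"
      using that by (simp add: pow_mult_distrib m_comm)
    also have "\<dots> = ((a \<otimes> b) [^] k) [^] ord b"
      using that(1,2) by (simp only: m_closed nat_pow_pow)
    also have "\<dots> = \<one>"
      using that by simp
    finally show ?thesis
      using that by (simp add: pow_eq_id coprime_dvd_mult_left_iff)
  qed
  have "ord x dvd ord (x \<otimes> y)"
    using assms by (intro *) auto
  moreover have "ord y dvd ord (x \<otimes> y)"
    using assms by (intro *[of y x]) (auto simp: m_comm coprime_commute)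
  ultimately show "ord x * ord y dvd ord (x \<otimes> y)"
    using assms(3) by (simp add: divides_mult)
qed

text \<open>An element \<open>x\<close> of maximal order works. If a prime \<open>p\<close> divided
  \<open>ord y\<close> to a higher power than \<open>ord x\<close>, exchanging the
  \<open>p\<close>-part of \<open>x\<close> for that of \<open>y\<close> would give the element
  \<open>x [^] (p ^ a) \<otimes> y [^] n\<close> of larger order \<open>m * p ^ b\<close>.\<close>

lemma (in comm_group) exists_exponent_element:
  assumes fin: "finite (carrier G)"
  obtains x where "x \<in> carrier G" "\<And>y. y \<in> carrier G \<Longrightarrow> ord y dvd ord x"
proof -
  have pos: "ord y > 0" if "y \<in> carrier G" for y
    using ord_ge_1[OF fin that] by simp
  have "finite (ord ` carrier G)" "ord ` carrier G \<noteq> {}"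
    using fin by auto
  then have "Max (ord ` carrier G) \<in> ord ` carrier G"
    by (rule Max_in)
  then obtain x where x: "x \<in> carrier G" and "ord x = Max (ord ` carrier G)"
    by auto
  then have max: "ord y \<le> ord x" if "y \<in> carrier G" for y
    using fin that by simp
  have "ord y dvd ord x" if y: "y \<in> carrier G" for y
  proof (rule multiplicity_le_imp_dvd)
    show "ord y \<noteq> 0" using pos[OF y] by simp
    fix p :: nat assume p: "prime p"
    define a b where "a = multiplicity p (ord x)" and "b = multiplicity p (ord y)"
    obtain m where m: "ord x = p ^ a * m" "\<not> p dvd m"
      using multiplicity_decompose'[of "ord x" p] pos[OF x] p
      unfolding a_def by (metis less_irrefl not_prime_unit)
    obtain n where n: "ord y = p ^ b * n" "\<not> p dvd n"
      using multiplicity_decompose'[of "ord y" p] pos[OF y] p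
      unfolding b_def by (metis less_irrefl not_prime_unit)
    have mn: "m > 0" "n > 0" "p > 0"
      using m n p by (auto intro!: gr0I)
    have 1: "ord (x [^] (p ^ a)) = m"
      using ord_pow[OF x, of "p ^ a"] m mn by simp
    have 2: "ord (y [^] n) = p ^ b"
      using ord_pow[OF y, of n] n mn by simp
    have "coprime m (p ^ b)"
      using m(2) p by (metis coprime_commute coprime_power_right_iff prime_imp_coprime)
    then have "ord (x [^] (p ^ a) \<otimes> y [^] n) = m * p ^ b"
      using 1 2 x y by (subst ord_mult_coprime) auto
    then have "m * p ^ b \<le> p ^ a * m"
      using max[of "x [^] (p ^ a) \<otimes> y [^] n"] x y m by simp
    then have "p ^ b \<le> p ^ a"
      using mn by (simp add: mult.commute)
    then show "multiplicity p (ord y) \<le> multiplicity p (ord x)"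
      using p prime_gt_1_nat by (simp flip: a_def b_def)
  qed
  with x show ?thesis using that by blast
qed

section \<open>Convexity of powers\<close>

text \<open>The power mean inequality for two numbers. The induction step is Chebyshev's inequality:
  \<open>x ^ n\<close> and \<open>y ^ n\<close> are ordered like \<open>x\<close> and
  \<open>y\<close>.\<close>

lemma sum_power_le_two_power_mult:
  fixes x y :: real
  assumes "x \<ge> 0" "y \<ge> 0" "n \<ge> 1"
  shows "(x + y) ^ n \<le> 2 ^ (n - 1) * (x ^ n + y ^ n)"
  using assms(3)
proof (induction n rule: nat_induct_at_least)
  case base
  show ?case by simp
next
  case (Suc n)
  have "0 \<le> (x ^ n - y ^ n) * (x - y)"
    using assms power_mono[of x y n] power_mono[of y x n]
    by (cases "x \<le> y") (auto intro!: mult_nonneg_nonneg mult_nonpos_nonpos)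
  then have *: "(x ^ n + y ^ n) * (x + y) \<le> 2 * (x ^ Suc n + y ^ Suc n)"
    by (simp add: algebra_simps)
  have "(x + y) ^ Suc n \<le> 2 ^ (n - 1) * (x ^ n + y ^ n) * (x + y)"
    using Suc assms by (simp add: mult.commute mult_left_mono)
  also have "\<dots> \<le> 2 ^ (n - 1) * (2 * (x ^ Suc n + y ^ Suc n))"
    unfolding mult.assoc using * by (intro mult_left_mono) auto
  also have "\<dots> = 2 ^ (Suc n - 1) * (x ^ Suc n + y ^ Suc n)"
    using Suc by (cases n) auto
  finally show ?case .
qed

lemma half_power_le_power_add:
  fixes a :: real
  assumes "0 \<le> a" "a \<le> 1" "n \<ge> 1"
  shows "(1 / 2) ^ (n - 1) \<le> a ^ n + (1 - a) ^ n"
  using sum_power_le_two_power_mult[of a "1 - a" n] assms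
  by (simp add: power_divide field_simps)

section \<open>Configurations of a form with coprime coefficients\<close>

locale coprime_form = comm_group G for G (structure) +
  fixes d :: nat and L :: "nat \<Rightarrow> int"
  assumes finite_carrier: "finite (carrier G)"
    and d_pos: "d \<ge> 1"
    and coprime_order: "i \<in> {1..d} \<Longrightarrow> coprime (L i) (int (order G))"
begin

abbreviation "C \<equiv> configuration G d L"

lemma finite_configuration: "finite C"
  unfolding configuration_def using finite_carrier by (auto intro!: finite_PiE)

lemma card_carrier_pos: "card (carrier G) > 0"
  using finite_carrier by (auto simp: card_gt_0_iff)

text \<open>By Bezout \<open>L i\<close> has an inverse \<open>u\<close> modulo the group order, and
  powers by multiples of the group order are trivial.\<close>

lemma pow_coprime_inverse:
  assumes "i \<in> {1..d}"
  obtains u :: int where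
    "\<And>x. x \<in> carrier G \<Longrightarrow> (x [^] L i) [^] u = x"
    "\<And>x. x \<in> carrier G \<Longrightarrow> (x [^] u) [^] L i = x"
proof -
  obtain u w where uw: "u * L i + w * int (order G) = 1"
    using coprime_order[OF assms] by (metis bezout_int coprime_imp_gcd_eq_1)
  have "x [^] (u * L i) = x" if x: "x \<in> carrier G" for x
  proof -
    have "x [^] (int (order G) * w) = (x [^] int (order G)) [^] w"
      using x by (simp add: int_pow_pow)
    also have "\<dots> = \<one>"
      using x by (simp add: int_pow_int pow_order_eq_1)
    finally have "x [^] (u * L i + w * int (order G)) = x [^] (u * L i)"
      using x by (simp add: int_pow_mult mult.commute)
    then show ?thesis
      using x uw by simp
  qed
  then have "(x [^] L i) [^] u = x" "(x [^] u) [^] L i = x" if "x \<in> carrier G" for x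
    using that by (simp_all add: int_pow_pow mult.commute)
  then show ?thesis using that by blast
qed

text \<open>The equation can be solved uniquely for coordinate \<open>j\<close>, because raising to
  the power \<open>L j\<close> is invertible. This is the independence of any \<open>d - 1\<close>
  coordinates.\<close>

lemma bij_betw_configuration:
  assumes j: "j \<in> {1..d}"
  shows "bij_betw (\<lambda>v. restrict v ({1..d} - {j})) C (({1..d} - {j}) \<rightarrow>\<^sub>E carrier G)"
proof -
  obtain u :: int where u: "\<And>x. x \<in> carrier G \<Longrightarrow> (x [^] L j) [^] u = x"
    "\<And>x. x \<in> carrier G \<Longrightarrow> (x [^] u) [^] L j = x"
    using pow_coprime_inverse[OF j] by metis
  define A where "A = {1..d} - {j}"
  have A: "{1..d} = insert j A" "finite A" "j \<notin> A"
    using j by (auto simp: A_def)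
  define R where "R p = finprod G (\<lambda>i. p i [^] L i) A" for p
  have R: "R p \<in> carrier G" if "\<And>i. i \<in> A \<Longrightarrow> p i \<in> carrier G" for p
    unfolding R_def using that by (intro finprod_closed) auto
  have R_cong: "R p = R q" if "\<And>i. i \<in> A \<Longrightarrow> p i = q i" "\<And>i. i \<in> A \<Longrightarrow> q i \<in> carrier G" for p q
    unfolding R_def using that by (intro finprod_cong') auto
  have in_A: "i \<in> {1..d} \<longleftrightarrow> i = j \<or> i \<in> A" for i
    using A(1) by blast
  have split: "finprod G (\<lambda>i. v i [^] L i) {1..d} = v j [^] L j \<otimes> R v"
    if "\<And>i. i \<in> {1..d} \<Longrightarrow> v i \<in> carrier G" for v
    unfolding A(1) R_def using that[unfolded in_A] A(2,3) by (subst finprod_insert) auto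
  \<comment> \<open>The inverse map fills in coordinate \<open>j\<close> with the solution of the
    equation; \<open>R p\<close> is the product of the other terms.\<close>
  define f' where "f' p = p(j := (inv (R p)) [^] u)" for p
  show ?thesis
    unfolding A_def[symmetric]
  proof (rule bij_betw_byWitness[where f' = f'])
    show "\<forall>v\<in>C. f' (restrict v A) = v"
    proof
      fix v assume v: "v \<in> C"
      then have vc: "v i \<in> carrier G" if "i \<in> {1..d}" for i
        using that by (auto simp: configuration_def)
      have Rr: "R (restrict v A) = R v"
        using vc[unfolded in_A] by (intro R_cong) auto
      have Rv: "R v \<in> carrier G"
        using vc[unfolded in_A] by (intro R) auto
      have "v j [^] L j \<otimes> R v = \<one>"
        using v split[of v] vc by (auto simp: configuration_def)
      then have "v j [^] L j = inv (R v)"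
        using vc[OF j] Rv by (metis int_pow_closed inv_equality)
      then have "(inv (R v)) [^] u = v j"
        using u(1)[OF vc[OF j]] by simp
      then show "f' (restrict v A) = v"
        using v in_A unfolding f'_def Rr
        by (fastforce simp: fun_eq_iff configuration_def PiE_def extensional_def)
    qed
    show "\<forall>p\<in>A \<rightarrow>\<^sub>E carrier G. restrict (f' p) A = p"
      using A(3) by (auto simp: f'_def fun_eq_iff PiE_def extensional_def)
    show "(\<lambda>v. restrict v A) ` C \<subseteq> A \<rightarrow>\<^sub>E carrier G"
      using in_A by (auto simp: configuration_def)
    show "f' ` (A \<rightarrow>\<^sub>E carrier G) \<subseteq> C"
    proof safe
      fix p assume p: "p \<in> A \<rightarrow>\<^sub>E carrier G"
      then have Rp: "R p \<in> carrier G"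
        by (intro R) auto
      have c: "f' p \<in> {1..d} \<rightarrow>\<^sub>E carrier G"
        unfolding A(1) using p Rp by (auto simp: f'_def PiE_def extensional_def)
      have "R (f' p) = R p"
        using p A(3) by (intro R_cong) (auto simp: f'_def)
      then have "finprod G (\<lambda>i. f' p i [^] L i) {1..d} = \<one>"
        using PiE_mem[OF c] Rp u(2) by (subst split) (simp_all add: f'_def)
      with c show "f' p \<in> C"
        by (simp add: configuration_def)
    qed
  qed
qed

text \<open>Coordinate \<open>j\<close> is determined by the others, which are free, so the sum
  factors. \<open>F\<close> may vary with the position, so that some factors can be set to
  1.\<close>

lemma sum_configuration_omit:
  fixes F :: "nat \<Rightarrow> 'a \<Rightarrow> real"
  assumes j: "j \<in> {1..d}"
  shows "(\<Sum>v\<in>C. \<Prod>i\<in>{1..d} - {j}. F i (v i)) = (\<Prod>i\<in>{1..d} - {j}. \<Sum>x\<in>carrier G. F i x)"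
proof -
  have "(\<Sum>v\<in>C. \<Prod>i\<in>{1..d} - {j}. F i (v i))
      = (\<Sum>p\<in>({1..d} - {j}) \<rightarrow>\<^sub>E carrier G. \<Prod>i\<in>{1..d} - {j}. F i (p i))"
    by (subst sum.reindex_bij_betw[OF bij_betw_configuration[OF j], symmetric]) simp
  also have "\<dots> = (\<Prod>i\<in>{1..d} - {j}. \<Sum>x\<in>carrier G. F i x)"
    using finite_carrier by (subst prod_sum_PiE) auto
  finally show ?thesis .
qed

lemma card_configuration: "card C = card (carrier G) ^ (d - 1)"
proof -
  have "card C = card (({1..d} - {1}) \<rightarrow>\<^sub>E carrier G)"
    using d_pos by (intro bij_betw_same_card[OF bij_betw_configuration]) auto
  also have "\<dots> = card (carrier G) ^ (d - 1)"
    using d_pos by (subst card_PiE) auto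
  finally show ?thesis .
qed

lemma arith_mult_eq:
  "arith_mult G d L f = (\<Sum>v\<in>C. \<Prod>i=1..d. f (v i)) / real (card (carrier G)) ^ (d - 1)"
  by (simp add: arith_mult_def card_configuration)

text \<open>Expand the product over the set \<open>B\<close> of positions where the constant is
  chosen. If \<open>B\<close> is neither empty nor everything, a coordinate in \<open>B\<close> can
  be omitted, the sum factors, and a position outside \<open>B\<close> contributes the factor
  \<open>\<Sum>x\<in>carrier G. g x\<close>, which is 0.\<close>

lemma arith_mult_const_add:
  assumes g: "(\<Sum>x\<in>carrier G. g x) = 0"
  shows "arith_mult G d L (\<lambda>x. a + g x) = a ^ d + arith_mult G d L g"
proof -
  let ?A = "{1..d}" and ?N = "real (card (carrier G))"
  have "(\<Sum>v\<in>C. \<Prod>i=1..d. (a + g (v i)))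
      = (\<Sum>v\<in>C. \<Sum>B\<in>Pow ?A. (\<Prod>i\<in>B. a) * (\<Prod>i\<in>?A - B. g (v i)))"
    by (simp add: prod_add)
  also have "\<dots> = (\<Sum>B\<in>Pow ?A. a ^ card B * (\<Sum>v\<in>C. \<Prod>i\<in>?A - B. g (v i)))"
    by (subst sum.swap) (simp add: sum_distrib_left)
  also have "\<dots> = (\<Sum>B\<in>{{}, ?A}. a ^ card B * (\<Sum>v\<in>C. \<Prod>i\<in>?A - B. g (v i)))"
  proof (rule sum.mono_neutral_right)
    show "\<forall>B\<in>Pow ?A - {{}, ?A}. a ^ card B * (\<Sum>v\<in>C. \<Prod>i\<in>?A - B. g (v i)) = 0"
    proof
      fix B assume B: "B \<in> Pow ?A - {{}, ?A}"
      then obtain j where j: "j \<in> ?A" "j \<in> B" by blast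
      from B obtain k where k: "k \<in> ?A" "k \<notin> B" by blast
      let ?F = "\<lambda>i x. if i \<in> B then 1 else g x"
      have "(\<Prod>i\<in>?A - B. g (v i)) = (\<Prod>i\<in>?A - {j}. ?F i (v i))" for v
        using j by (intro prod.mono_neutral_cong_left) auto
      then have "(\<Sum>v\<in>C. \<Prod>i\<in>?A - B. g (v i)) = (\<Prod>i\<in>?A - {j}. \<Sum>x\<in>carrier G. ?F i x)"
        using sum_configuration_omit[OF j(1), of ?F] by simp
      also have "\<dots> = 0"
        using j k g by (intro prod_zero) (auto intro!: bexI[of _ k])
      finally show "a ^ card B * (\<Sum>v\<in>C. \<Prod>i\<in>?A - B. g (v i)) = 0" by simp
    qed
  qed auto
  also have "\<dots> = (\<Sum>v\<in>C. \<Prod>i\<in>?A. g (v i)) + a ^ d * ?N ^ (d - 1)"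
    using d_pos by (simp add: card_configuration)
  finally show ?thesis
    using card_carrier_pos by (simp add: arith_mult_eq add_divide_distrib)
qed

lemma arith_mult_uminus: "arith_mult G d L (\<lambda>x. - f x) = (- 1) ^ d * arith_mult G d L f"
  by (simp add: arith_mult_eq prod_uminus sum_distrib_left)

lemma sum_carrier_eq: "(\<Sum>x\<in>carrier G. f x) = real (card (carrier G)) * expect (carrier G) f"
  using card_carrier_pos by (simp add: expect_def)

text \<open>Both follow from \<open>arith_mult_const_add\<close>, as \<open>1 - f\<close> is
  \<open>1 - a\<close> plus the negated deviation \<open>f - a\<close>. The two deviation terms
  cancel for odd \<open>d\<close> and agree for even \<open>d\<close>.\<close>

lemma arith_mult_deviation:
  fixes f :: "'a \<Rightarrow> real"
  defines "a \<equiv> expect (carrier G) f"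
  shows "arith_mult G d L f = a ^ d + arith_mult G d L (\<lambda>x. f x - a)"
    and "arith_mult G d L (\<lambda>x. 1 - f x) = (1 - a) ^ d + (- 1) ^ d * arith_mult G d L (\<lambda>x. f x - a)"
proof -
  have 0: "(\<Sum>x\<in>carrier G. f x - a) = 0"
    by (simp add: sum_subtractf sum_carrier_eq[of f] a_def)
  show "arith_mult G d L f = a ^ d + arith_mult G d L (\<lambda>x. f x - a)"
    using arith_mult_const_add[OF 0, of a] by simp
  have "(\<Sum>x\<in>carrier G. - (f x - a)) = 0"
    using 0 by (simp only: sum_negf)
  from arith_mult_const_add[OF this, of "1 - a"] arith_mult_uminus[of "\<lambda>x. f x - a"]
  show "arith_mult G d L (\<lambda>x. 1 - f x) = (1 - a) ^ d + (- 1) ^ d * arith_mult G d L (\<lambda>x. f x - a)"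
    by simp
qed

lemma expect_bounds:
  assumes "f \<in> carrier G \<rightarrow> {0..1::real}"
  shows "0 \<le> expect (carrier G) f" "expect (carrier G) f \<le> 1"
proof -
  show "0 \<le> expect (carrier G) f"
    unfolding expect_def using assms by (auto intro!: divide_nonneg_nonneg sum_nonneg)
  have "(\<Sum>x\<in>carrier G. f x) \<le> of_nat (card (carrier G)) * 1"
    using assms by (intro sum_bounded_above) auto
  then show "expect (carrier G) f \<le> 1"
    unfolding expect_def using card_carrier_pos by (simp add: divide_le_eq)
qed

section \<open>Odd number of variables\<close>

lemma odd_imp_fully_common:
  assumes "odd d"
  shows "fully_common G d L"
  unfolding fully_common_def
proof
  fix f :: "'a \<Rightarrow> real"
  assume f: "f \<in> carrier G \<rightarrow> {0..1}"
  show "(1 / 2) ^ (d - 1) \<le> arith_mult G d L f + arith_mult G d L (\<lambda>x. 1 - f x)"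
    using half_power_le_power_add[OF expect_bounds[OF f] d_pos] assms
      arith_mult_deviation[of f] by simp
qed

text \<open>For the indicator of the unit only the constant tuple \<open>v0\<close> contributes, so
  its multiplicity is \<open>1 / ?N ^ (d - 1)\<close>, strictly above the bound
  \<open>1 / ?N ^ d\<close>. For odd \<open>d\<close> the complement falls below its own bound by
  the same amount. In the trivial group equality always holds, whence
  \<open>order G > 1\<close>.\<close>

lemma odd_imp_not_fully_Sidorenko:
  assumes "odd d" "order G > 1"
  shows "\<not> fully_Sidorenko G d L"
proof
  assume S: "fully_Sidorenko G d L"
  let ?N = "real (card (carrier G))"
  define f :: "'a \<Rightarrow> real" where "f x = of_bool (x = \<one>)" for x
  define v0 where "v0 = (\<lambda>i\<in>{1..d}. \<one>)"
  have N: "?N > 1" using assms(2) by (simp add: order_def)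
  have "(\<Sum>v\<in>C. \<Prod>i=1..d. f (v i)) = (\<Sum>v\<in>{v0}. \<Prod>i=1..d. f (v i))"
  proof (rule sum.mono_neutral_right)
    show "{v0} \<subseteq> C"
      by (auto simp: v0_def configuration_def intro!: finprod_one_eqI)
    show "\<forall>v\<in>C - {v0}. (\<Prod>i=1..d. f (v i)) = 0"
    proof
      fix v assume "v \<in> C - {v0}"
      then have "v \<in> {1..d} \<rightarrow>\<^sub>E carrier G" "v0 \<in> {1..d} \<rightarrow>\<^sub>E carrier G" "v \<noteq> v0"
        by (auto simp: v0_def configuration_def)
      then obtain i where "i \<in> {1..d}" "v i \<noteq> v0 i"
        using PiE_ext by metis
      then show "(\<Prod>i=1..d. f (v i)) = 0"
        by (intro prod_zero) (auto simp: f_def v0_def intro!: bexI[of _ i])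
    qed
  qed (rule finite_configuration)
  also have "\<dots> = 1" by (simp add: f_def v0_def)
  finally have t: "arith_mult G d L f = 1 / ?N ^ (d - 1)"
    by (simp add: arith_mult_eq)
  have a: "expect (carrier G) f = 1 / ?N"
    using finite_carrier by (simp add: expect_def f_def of_bool_def sum.delta)
  have "expect (carrier G) (\<lambda>x. 1 - f x) = 1 - 1 / ?N"
    using a card_carrier_pos by (simp add: expect_def sum_subtractf diff_divide_distrib)
  moreover have "expect (carrier G) (\<lambda>x. 1 - f x) ^ d \<le> arith_mult G d L (\<lambda>x. 1 - f x)"
    using S unfolding fully_Sidorenko_def by (auto simp: f_def of_bool_def)
  ultimately have "1 / ?N ^ (d - 1) \<le> (1 / ?N) ^ d"
    using arith_mult_deviation[of f] assms(1) t a by simp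
  also have "\<dots> = 1 / ?N ^ (d - 1) / ?N"
    using d_pos by (cases d) (auto simp: power_divide)
  finally show False
    using N by (simp add: field_simps)
qed

section \<open>Commonness from the Sidorenko property, and its failure near 1/2\<close>

lemma fully_Sidorenko_imp_fully_common:
  assumes "fully_Sidorenko G d L"
  shows "fully_common G d L"
  unfolding fully_common_def
proof
  fix f :: "'a \<Rightarrow> real"
  assume f: "f \<in> carrier G \<rightarrow> {0..1}"
  have "expect (carrier G) (\<lambda>x. 1 - f x) = 1 - expect (carrier G) f"
    using card_carrier_pos by (simp add: expect_def sum_subtractf diff_divide_distrib)
  moreover have "expect (carrier G) (\<lambda>x. 1 - f x) ^ d \<le> arith_mult G d L (\<lambda>x. 1 - f x)"
    "expect (carrier G) f ^ d \<le> arith_mult G d L f"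
    using assms f unfolding fully_Sidorenko_def by (auto simp: Pi_iff)
  ultimately show "(1 / 2) ^ (d - 1) \<le> arith_mult G d L f + arith_mult G d L (\<lambda>x. 1 - f x)"
    using half_power_le_power_add[OF expect_bounds[OF f] d_pos] by simp
qed

text \<open>Perturb the constant 1/2 by a small positive multiple \<open>h\<close> of
  \<open>g\<close>. For even \<open>d\<close> the functions \<open>1 / 2 + h\<close> and
  \<open>1 / 2 - h\<close> have multiplicities adding up to \<open>(1 / 2) ^ (d - 1)\<close> plus
  twice that of \<open>h\<close>, which is negative.\<close>

lemma not_fully_common:
  assumes "even d" and g: "(\<Sum>x\<in>carrier G. g x) = 0" and neg: "arith_mult G d L g < 0"
  shows "\<not> fully_common G d L"
proof
  assume common: "fully_common G d L"
  \<comment> \<open>\<open>K\<close> bounds every \<open>\<bar>g x\<bar>\<close>, so that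
    \<open>h\<close> stays within 1/2 of zero; the summand 1 keeps it positive.\<close>
  define K where "K = (\<Sum>x\<in>carrier G. \<bar>g x\<bar>) + 1"
  have K: "K > 0" "\<bar>g x\<bar> \<le> K" if "x \<in> carrier G" for x
    using member_le_sum[of x "carrier G" "\<lambda>x. \<bar>g x\<bar>"] that finite_carrier
    by (auto simp: K_def intro!: add_nonneg_pos sum_nonneg)
  have K_pos: "K > 0" using K(1)[OF one_closed] .
  define h where "h x = g x / (2 * K)" for x
  have h0: "(\<Sum>x\<in>carrier G. h x) = 0"
    using g by (simp add: h_def flip: sum_divide_distrib)
  have h: "arith_mult G d L h = arith_mult G d L g / (2 * K) ^ d"
    by (simp add: arith_mult_eq h_def prod_dividef flip: sum_divide_distrib)
  then have h_neg: "arith_mult G d L h < 0"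
    using neg K_pos by (simp add: divide_neg_pos)
  have "1 / 2 + h x \<in> {0..1}" if "x \<in> carrier G" for x
    using K[OF that] by (auto simp: h_def field_simps abs_le_iff)
  then have "(\<lambda>x. 1 / 2 + h x) \<in> carrier G \<rightarrow> {0..1}"
    by (rule Pi_I)
  then have "(1 / 2) ^ (d - 1)
      \<le> arith_mult G d L (\<lambda>x. 1 / 2 + h x) + arith_mult G d L (\<lambda>x. 1 - (1 / 2 + h x))"
    using common unfolding fully_common_def by (rule bspec[rotated])
  also have "(\<lambda>x. 1 - (1 / 2 + h x)) = (\<lambda>x. 1 / 2 + - h x)"
    by auto
  also have "arith_mult G d L (\<lambda>x. 1 / 2 + h x) + arith_mult G d L (\<lambda>x. 1 / 2 + - h x)
      = 2 * (1 / 2) ^ d + 2 * arith_mult G d L h"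
    using \<open>even d\<close> h0 by (subst (1 2) arith_mult_const_add) (simp_all add: sum_negf arith_mult_uminus)
  also have "2 * (1 / 2) ^ d = (1 / 2 :: real) ^ (d - 1)"
    using d_pos by (cases d) auto
  finally show False using h_neg by simp
qed

end

section \<open>Roots of unity and orthogonality\<close>

text \<open>Used with two moduli: the order \<open>e\<close> of the cyclic group, for its
  characters, and a power \<open>b ^ e\<close>, for the phases attached to them.\<close>

definition unity :: "nat \<Rightarrow> int \<Rightarrow> complex"
  where "unity M m = cis (2 * pi * of_int m / of_nat M)"

lemma unity_0 [simp]: "unity M 0 = 1"
  by (simp add: unity_def)

lemma unity_add: "unity M (m + n) = unity M m * unity M n"
  by (simp add: unity_def cis_mult add_divide_distrib ring_distribs)

lemma unity_sum: "unity M (\<Sum>i\<in>A. m i) = (\<Prod>i\<in>A. unity M (m i))"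
  by (induction A rule: infinite_finite_induct) (simp_all add: unity_add)

lemma cnj_unity: "cnj (unity M m) = unity M (- m)"
  by (simp add: unity_def cis_cnj)

lemma unity_power: "unity M (m * int n) = unity M m ^ n"
  by (simp add: unity_def DeMoivre mult_ac)

lemma unity_eq_1_iff:
  assumes "M > 0"
  shows "unity M m = 1 \<longleftrightarrow> int M dvd m"
proof
  assume "unity M m = 1"
  then have "cos (2 * pi * of_int m / of_nat M) = 1"
    by (simp add: unity_def complex_eq_iff)
  then obtain n :: int where "2 * pi * of_int m / of_nat M = of_int n * 2 * pi"
    by (auto simp: cos_one_2pi_int)
  then have "real_of_int m = of_int (n * int M)"
    using assms by (simp add: field_simps)
  then have "m = n * int M"
    by (simp only: of_int_eq_iff)
  then show "int M dvd m" by simp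
next
  assume "int M dvd m"
  then obtain n where "m = int M * n" ..
  then show "unity M m = 1"
    using assms cis_multiple_2pi[of "of_int n"] by (simp add: unity_def mult.assoc)
qed

lemma unity_cong:
  assumes "M > 0" "int M dvd m - n"
  shows "unity M m = unity M n"
  using unity_add[of M "m - n" n] unity_eq_1_iff[OF assms(1), of "m - n"] assms(2) by simp

lemma sum_unity:
  assumes "M > 0"
  shows "(\<Sum>n<M. unity M (m * int n)) = (if int M dvd m then of_nat M else 0)"
proof (cases "int M dvd m")
  case True
  then show ?thesis
    using unity_eq_1_iff[OF assms, of m] by (simp add: unity_power)
next
  case False
  then have "unity M m \<noteq> 1" and "unity M m ^ M = 1"
    using unity_eq_1_iff[OF assms] by (simp_all flip: unity_power)
  then show ?thesis
    using False by (simp add: unity_power geometric_sum)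
qed

text \<open>By orthogonality the divisibility condition is an average over the characters
  \<open>c\<close>; after exchanging the sums, the sum over \<open>v\<close> factors into Fourier
  coefficients of \<open>h\<close> at the frequencies \<open>c * L i\<close>.\<close>

lemma sum_prod_linear_equation_eq:
  fixes h :: "nat \<Rightarrow> complex" and L :: "nat \<Rightarrow> int"
  assumes e: "e > 0" and A: "finite A"
  shows "of_nat e * (\<Sum>v | v \<in> A \<rightarrow>\<^sub>E {..<e} \<and> int e dvd (\<Sum>i\<in>A. L i * int (v i)). \<Prod>i\<in>A. h (v i))
    = (\<Sum>c<e. \<Prod>i\<in>A. \<Sum>n<e. unity e (- (int c * L i * int n)) * h n)"
proof -
  let ?V = "A \<rightarrow>\<^sub>E {..<e}"
  let ?S = "\<lambda>v. \<Sum>i\<in>A. L i * int (v i)"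
  have fV: "finite ?V"
    using A by (auto intro: finite_PiE)
  have "(\<Sum>c<e. \<Prod>i\<in>A. \<Sum>n<e. unity e (- (int c * L i * int n)) * h n)
      = (\<Sum>c<e. \<Sum>v\<in>?V. \<Prod>i\<in>A. unity e (- (int c * L i * int (v i))) * h (v i))"
    using A by (subst prod_sum_PiE) auto
  also have "\<dots> = (\<Sum>c<e. \<Sum>v\<in>?V. unity e (- ?S v * int c) * (\<Prod>i\<in>A. h (v i)))"
    by (simp add: prod.distrib sum_distrib_left sum_distrib_right sum_negf[symmetric] mult_ac flip: unity_sum)
  also have "\<dots> = (\<Sum>v\<in>?V. (\<Sum>c<e. unity e (- ?S v * int c)) * (\<Prod>i\<in>A. h (v i)))"
    by (subst sum.swap) (simp add: sum_distrib_right)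
  also have "\<dots> = (\<Sum>v\<in>?V. if int e dvd ?S v then of_nat e * (\<Prod>i\<in>A. h (v i)) else 0)"
    by (intro sum.cong refl) (simp add: sum_unity[OF e] del: mult_minus_left)
  also have "\<dots> = of_nat e * (\<Sum>v | v \<in> ?V \<and> int e dvd ?S v. \<Prod>i\<in>A. h (v i))"
    using fV by (simp add: sum.inter_filter sum_distrib_left if_distrib[of "(*) _"] cong: if_cong)
  finally show ?thesis by simp
qed

section \<open>Signed digits and generic weights\<close>

text \<open>Modulo \<open>b\<close> only \<open>D 0\<close> remains, and a multiple of
  \<open>b\<close> smaller than \<open>b\<close> in absolute value is 0. Dividing by
  \<open>b\<close> leaves the same statement for the shifted digits.\<close>

lemma sum_digits_eq_0:
  fixes D :: "nat \<Rightarrow> int"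
  assumes "\<And>s. \<bar>D s\<bar> < b" "b ^ e dvd (\<Sum>s<e. b ^ s * D s)" "s < e"
  shows "D s = 0"
  using assms
proof (induction e arbitrary: D s)
  case 0
  then show ?case by simp
next
  case (Suc e)
  have b: "b > 0"
    using Suc.prems(1)[of 0] by linarith
  have eq: "(\<Sum>s<Suc e. b ^ s * D s) = D 0 + b * (\<Sum>s<e. b ^ s * D (Suc s))"
    by (subst sum.lessThan_Suc_shift) (simp add: sum_distrib_left mult.assoc)
  have "b dvd D 0 + b * (\<Sum>s<e. b ^ s * D (Suc s))"
    using Suc.prems(2) unfolding eq by (rule dvd_trans[rotated]) simp
  then have "b dvd D 0"
    by (simp add: dvd_add_left_iff)
  then have D0: "D 0 = 0"
    using Suc.prems(1)[of 0] by (meson dvd_imp_le_int linorder_not_less abs_le_iff abs_of_nonneg order.trans abs_ge_self)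
  have "b ^ e dvd (\<Sum>s<e. b ^ s * D (Suc s))"
    using Suc.prems(2) b unfolding eq D0 by simp
  then have "D (Suc s) = 0" if "s < e" for s
    using Suc.IH[of "\<lambda>s. D (Suc s)"] Suc.prems(1) that by blast
  with D0 Suc.prems(3) show ?case
    by (cases s) auto
qed

text \<open>Unfolded, the weight of \<open>k\<close> is \<open>b\<^sup>k\<close> for \<open>2k < e\<close> and \<open>- b\<^bsup>e-k\<^esup>\<close> for \<open>2k > e\<close>. It is odd under
  \<open>k \<mapsto> e - k\<close>, which makes the trigonometric polynomial with phases \<open>w(k)\<close> real, and for a large
  base a vanishing sum of weights forces the multiset of summands to be symmetric.\<close>

definition digit :: "nat \<Rightarrow> nat \<Rightarrow> nat \<Rightarrow> int"
  where "digit e s k = (if 2 * s < e then of_bool (k = s) - of_bool (k + s = e) else 0)"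

definition weight :: "nat \<Rightarrow> int \<Rightarrow> nat \<Rightarrow> int"
  where "weight e b k = (\<Sum>s<e. b ^ s * digit e s k)"

lemma weight_reflect: "k < e \<Longrightarrow> 0 < k \<Longrightarrow> weight e b (e - k) = - weight e b k"
  unfolding weight_def sum_negf[symmetric]
  by (intro sum.cong refl) (auto simp: digit_def)

text \<open>Digit \<open>s\<close> of the sum, for \<open>2 * s < e\<close>, is the number of
  indices with \<open>r i = s\<close> minus that with \<open>r i + s = e\<close>. It is at most
  \<open>card A\<close> in absolute value, hence less than \<open>b\<close>, so all these
  differences vanish.\<close>

lemma weight_sum_dvd_imp_card_eq:
  assumes A: "finite A" and b: "int (card A) < b"
    and dvd: "b ^ e dvd (\<Sum>i\<in>A. weight e b (r i))" and t: "2 * t < e"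
  shows "card {i \<in> A. r i = t} = card {i \<in> A. r i + t = e}"
proof -
  have "(\<Sum>i\<in>A. weight e b (r i)) = (\<Sum>s<e. b ^ s * (\<Sum>i\<in>A. digit e s (r i)))"
    unfolding weight_def by (subst sum.swap) (simp add: sum_distrib_left)
  with dvd have dvd': "b ^ e dvd (\<Sum>s<e. b ^ s * (\<Sum>i\<in>A. digit e s (r i)))"
    by simp
  have "\<bar>\<Sum>i\<in>A. digit e s (r i)\<bar> < b" for s
  proof -
    have "\<bar>\<Sum>i\<in>A. digit e s (r i)\<bar> \<le> (\<Sum>i\<in>A. \<bar>digit e s (r i)\<bar>)"
      by (rule sum_abs)
    also have "\<dots> \<le> of_nat (card A) * 1"
      by (intro sum_bounded_above) (auto simp: digit_def)
    finally show ?thesis using b by simp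
  qed
  from sum_digits_eq_0[OF this dvd', of t] t have "(\<Sum>i\<in>A. digit e t (r i)) = 0"
    by simp
  then have "(\<Sum>i\<in>A. of_bool (r i = t)) = (\<Sum>i\<in>A. of_bool (r i + t = e) :: int)"
    using t by (simp add: digit_def sum_subtractf)
  then show ?thesis
    using A by (simp add: of_bool_def sum.If_cases Int_def)
qed

section \<open>A negative sum over solutions in a cyclic group\<close>

text \<open>The phase \<theta> is discretized as \<open>2 * pi * j / M\<close> with
  \<open>M = b ^ e\<close>, so the average is a finite sum over \<open>j\<close>. Hypothesis
  \<open>no_dvd\<close> says that no frequency \<open>W c\<close> with \<open>c\<close> a unit
  vanishes modulo \<open>M\<close>.\<close>

lemma exists_negative_on_cyclic:
  fixes L :: "nat \<Rightarrow> int"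
  assumes e: "e \<ge> 2" and A: "finite A" "A \<noteq> {}"
    and cop: "\<And>i. i \<in> A \<Longrightarrow> coprime (L i) (int e)" and b: "b > 0"
    and no_dvd: "\<And>c. coprime c e \<Longrightarrow> c < e \<Longrightarrow>
      \<not> int b ^ e dvd (\<Sum>i\<in>A. weight e (int b) (nat (int c * L i mod int e)))"
  obtains h :: "nat \<Rightarrow> real" where "(\<Sum>n<e. h n) = 0"
    "(\<Sum>v | v \<in> A \<rightarrow>\<^sub>E {..<e} \<and> int e dvd (\<Sum>i\<in>A. L i * int (v i)). \<Prod>i\<in>A. h (v i)) < 0"
proof -
  define M where "M = b ^ e"
  define U where "U = {k. k < e \<and> coprime k e}"
  define w where "w = weight e (int b)"
  define res where "res m = nat (m mod int e)" for m
  define W where "W c = (\<Sum>i\<in>A. w (res (int c * L i)))" for c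
  define h where "h j n = (\<Sum>k\<in>U. unity e (int k * int n) * unity M (w k * int j))" for j n
  define V where "V = {v. v \<in> A \<rightarrow>\<^sub>E {..<e} \<and> int e dvd (\<Sum>i\<in>A. L i * int (v i))}"
  define T where "T j = (\<Sum>v\<in>V. \<Prod>i\<in>A. Re (h j (v i)))" for j
  have M: "M > 0" using b by (simp add: M_def)
  have U_fin: "finite U" by (simp add: U_def)
  have U_pos: "0 < k" "k < e" if "k \<in> U" for k
    using that e by (auto simp: U_def intro!: gr0I)
  have U_reflect: "e - k \<in> U" if "k \<in> U" for k
    using that U_pos[OF that] gcd_diff2_nat[of k e] by (auto simp: U_def coprime_iff_gcd_eq_1 gcd.commute)
  \<comment> \<open>Conjugation permutes the terms: the units are symmetric under
    \<open>k \<mapsto> e - k\<close>, and \<open>w\<close> is odd under it.\<close>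
  have "cnj (h j n) = h j n" for j n
  proof -
    have "cnj (h j n) = (\<Sum>k\<in>U. unity e (- (int k * int n)) * unity M (- w k * int j))"
      by (simp add: h_def cnj_unity)
    also have "\<dots> = h j n"
      unfolding h_def
    proof (rule sum.reindex_bij_witness[where i = "\<lambda>k. e - k" and j = "\<lambda>k. e - k"])
      fix k assume k: "k \<in> U"
      show "e - (e - k) = k" "e - k \<in> U"
        using U_pos[OF k] U_reflect[OF k] by auto
      have "unity e (int (e - k) * int n) = unity e (- (int k * int n))"
        using U_pos[OF k] by (intro unity_cong) (auto simp: of_nat_diff algebra_simps)
      moreover have "w (e - k) = - w k"
        using U_pos[OF k] by (simp add: w_def weight_reflect)
      ultimately show "unity e (int (e - k) * int n) * unity M (w (e - k) * int j)
          = unity e (- (int k * int n)) * unity M (- w k * int j)"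
        by simp
    qed (use U_pos(2) U_reflect in \<open>auto simp: less_imp_le\<close>)
    finally show ?thesis .
  qed
  then have h_real: "of_real (Re (h j n)) = h j n" for j n
    by (simp add: complex_eq_iff)
  \<comment> \<open>The Fourier coefficients of \<open>h j\<close>: of modulus \<open>e\<close> at
    the units and zero elsewhere.\<close>
  have coeff: "(\<Sum>n<e. unity e (- (m * int n)) * h j n)
      = (if res m \<in> U then of_nat e * unity M (w (res m) * int j) else 0)" for m j
  proof -
    have "(\<Sum>n<e. unity e (- (m * int n)) * h j n)
        = (\<Sum>n<e. \<Sum>k\<in>U. unity M (w k * int j) * unity e ((int k - m) * int n))"
    proof -
      have "unity e ((int k - m) * int n) = unity e (- (m * int n)) * unity e (int k * int n)" for k n
        by (simp add: algebra_simps flip: unity_add)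
      then show ?thesis
        by (simp add: h_def sum_distrib_left mult_ac)
    qed
    also have "\<dots> = (\<Sum>k\<in>U. unity M (w k * int j) * (\<Sum>n<e. unity e ((int k - m) * int n)))"
      by (subst sum.swap) (simp add: sum_distrib_left)
    also have "\<dots> = (\<Sum>k\<in>U. if k = res m then of_nat e * unity M (w k * int j) else 0)"
    proof (intro sum.cong refl)
      fix k assume "k \<in> U"
      then have "int e dvd int k - m \<longleftrightarrow> k = res m"
        using U_pos e by (auto simp: res_def mod_eq_dvd_iff[symmetric])
      then show "unity M (w k * int j) * (\<Sum>n<e. unity e ((int k - m) * int n))
          = (if k = res m then of_nat e * unity M (w k * int j) else 0)"
        using e by (subst sum_unity) auto
    qed
    also have "\<dots> = (if res m \<in> U then of_nat e * unity M (w (res m) * int j) else 0)"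
      using U_fin by simp
    finally show ?thesis .
  qed
  \<comment> \<open>As each \<open>L i\<close> is a unit modulo \<open>e\<close>, the coefficients
    for a given \<open>c\<close> are all nonzero or all zero; only the units \<open>c\<close>
    contribute to \<open>T j\<close>.\<close>
  have res_U: "res (int c * L i) \<in> U \<longleftrightarrow> c \<in> U" if "i \<in> A" "c < e" for c i
  proof -
    have "coprime (res (int c * L i)) e \<longleftrightarrow> coprime (int (res (int c * L i))) (int e)"
      by (simp only: coprime_int_iff)
    also have "\<dots> \<longleftrightarrow> coprime (int c * L i) (int e)"
      using e by (simp add: res_def coprime_mod_left_iff)
    also have "\<dots> \<longleftrightarrow> coprime c e"
      using cop[OF that(1)] by simp
    finally show ?thesis
      using that e by (auto simp: U_def res_def nat_less_iff)
  qed
  have T: "of_nat e * of_real (T j) = of_nat e ^ card A * (\<Sum>c\<in>U. unity M (W c * int j))" for j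
  proof -
    have "of_nat e * of_real (T j) = of_nat e * (\<Sum>v\<in>V. \<Prod>i\<in>A. h j (v i))"
      by (simp add: T_def h_real)
    also have "\<dots> = (\<Sum>c<e. \<Prod>i\<in>A. \<Sum>n<e. unity e (- (int c * L i * int n)) * h j n)"
      unfolding V_def using e A by (subst sum_prod_linear_equation_eq) auto
    also have "\<dots> = (\<Sum>c<e. \<Prod>i\<in>A. if c \<in> U then of_nat e * unity M (w (res (int c * L i)) * int j) else 0)"
      by (intro sum.cong prod.cong refl) (simp add: coeff res_U)
    also have "\<dots> = (\<Sum>c<e. if c \<in> U then of_nat e ^ card A * unity M (W c * int j) else 0)"
      using A by (intro sum.cong refl)
        (auto simp: prod.distrib W_def sum_distrib_right simp flip: unity_sum)
    also have "\<dots> = (\<Sum>c\<in>U. of_nat e ^ card A * unity M (W c * int j))"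
      using U_pos by (intro sum.mono_neutral_cong_right) auto
    finally show ?thesis
      by (simp add: sum_distrib_left)
  qed
  have "(\<Sum>j<M. of_nat e * complex_of_real (T j))
      = of_nat e ^ card A * (\<Sum>c\<in>U. \<Sum>j<M. unity M (W c * int j))"
    by (subst sum.swap) (simp add: T sum_distrib_left)
  also have "\<dots> = 0"
  proof -
    have "\<not> int M dvd W c" if "c \<in> U" for c
      using no_dvd[of c] that by (simp add: U_def W_def w_def M_def res_def)
    then show ?thesis by (simp add: sum_unity[OF M])
  qed
  also have "(\<Sum>j<M. of_nat e * complex_of_real (T j)) = of_nat e * of_real (\<Sum>j<M. T j)"
    by (simp add: sum_distrib_left)
  finally have avg: "(\<Sum>j<M. T j) = 0"
    using e by (simp del: of_real_sum)
  have "1 \<in> U" using e by (simp add: U_def)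
  then have "card U > 0" using U_fin by (auto simp: card_gt_0_iff)
  \<comment> \<open>At \<open>j = 0\<close> all phases are 1, so \<open>T 0\<close> is positive; as
    the total is 0, some other \<open>T j\<close> is negative.\<close>
  moreover have "real e * T 0 = real e ^ card A * real (card U)"
    using arg_cong[OF T[of 0], of Re] by simp
  ultimately have "real e * T 0 > 0"
    using e by simp
  then have "T 0 > 0"
    using e by (simp add: zero_less_mult_iff)
  then have "\<exists>j<M. T j < 0"
    using avg M sum_nonneg_eq_0_iff[of "{..<M}" T] by (force simp: not_less)
  then obtain j where j: "T j < 0" by blast
  \<comment> \<open>The sum of \<open>h j\<close> is its Fourier coefficient at frequency 0, which
    is not a unit because \<open>e \<ge> 2\<close>.\<close>
  have "0 \<notin> U" using U_pos by blast
  then have "(\<Sum>n<e. h j n) = 0"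
    using coeff[of 0 j] by (simp add: res_def)
  then have "(\<Sum>n<e. Re (h j n)) = 0"
    by (metis Re_sum zero_complex.sel(1))
  then show ?thesis
    using j that[of "\<lambda>n. Re (h j n)"] by (simp add: T_def V_def)
qed

section \<open>Matching of opposite residues\<close>

text \<open>For each \<open>t\<close> the fibres over \<open>t\<close> and \<open>e - t\<close> are
  in bijection; \<sigma> glues these bijections together. Indices with \<open>2 * r i = e\<close>
  stay unmatched.\<close>

lemma exists_symmetric_matching:
  fixes r :: "'i \<Rightarrow> nat"
  assumes A: "finite A"
    and eq: "\<And>t. 2 * t < e \<Longrightarrow> card {i \<in> A. r i = t} = card {i \<in> A. r i + t = e}"
  obtains \<sigma> where "bij_betw \<sigma> {i \<in> A. 2 * r i < e} {i \<in> A. 2 * r i > e \<and> r i \<le> e}"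
    "\<And>i. i \<in> A \<Longrightarrow> 2 * r i < e \<Longrightarrow> r i + r (\<sigma> i) = e"
proof -
  have "\<exists>h. bij_betw h {i \<in> A. r i = t} {i \<in> A. r i + t = e}" if "2 * t < e" for t
    using A eq[OF that] by (intro finite_same_card_bij) auto
  then obtain h where h: "bij_betw (h t) {i \<in> A. r i = t} {i \<in> A. r i + t = e}" if "2 * t < e" for t
    by metis
  define \<sigma> where "\<sigma> i = h (r i) i" for i
  have \<sigma>: "\<sigma> i \<in> A" "r i + r (\<sigma> i) = e" if "i \<in> A" "2 * r i < e" for i
    using bij_betwE[OF h[OF that(2)]] that by (auto simp: \<sigma>_def)
  show ?thesis
  proof
    show "bij_betw \<sigma> {i \<in> A. 2 * r i < e} {i \<in> A. 2 * r i > e \<and> r i \<le> e}"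
    proof (rule bij_betw_imageI)
      show "inj_on \<sigma> {i \<in> A. 2 * r i < e}"
      proof (rule inj_onI, safe)
        fix i j assume ij: "i \<in> A" "2 * r i < e" "j \<in> A" "2 * r j < e" "\<sigma> i = \<sigma> j"
        then have "r i = r j"
          using \<sigma>(2)[of i] \<sigma>(2)[of j] by simp
        then show "i = j"
          using ij bij_betw_imp_inj_on[OF h[OF ij(2)]] by (auto simp: \<sigma>_def inj_on_def)
      qed
      show "\<sigma> ` {i \<in> A. 2 * r i < e} = {i \<in> A. 2 * r i > e \<and> r i \<le> e}"
      proof safe
        fix i assume "i \<in> A" "2 * r i < e"
        then show "\<sigma> i \<in> A" "2 * r (\<sigma> i) > e" "r (\<sigma> i) \<le> e"
          using \<sigma>[of i] by auto
      next
        fix j assume j: "j \<in> A" "2 * r j > e" "r j \<le> e"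
        define t where "t = e - r j"
        have t: "2 * t < e" "r j + t = e" using j by (auto simp: t_def)
        then have "j \<in> h t ` {i \<in> A. r i = t}"
          using h[OF t(1)] j by (simp add: bij_betw_def)
        then obtain i where "i \<in> A" "r i = t" "h t i = j"
          by auto
        then show "j \<in> \<sigma> ` {i \<in> A. 2 * r i < e}"
          using t by (auto simp: \<sigma>_def image_iff intro!: exI[of _ i])
      qed
    qed
  qed (use \<sigma> in auto)
qed

section \<open>Cauchy-Schwarz and canceling partitions\<close>

lemma sum_squared_le_card_mult_sum_squares:
  fixes F :: "'i \<Rightarrow> real"
  assumes "finite A"
  shows "(\<Sum>y\<in>A. F y)\<^sup>2 \<le> real (card A) * (\<Sum>y\<in>A. (F y)\<^sup>2)"
proof (cases "A = {}")
  case False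
  define S where "S = (\<Sum>y\<in>A. F y)"
  define N where "N = real (card A)"
  have N: "N > 0" using assms False by (simp add: N_def card_gt_0_iff)
  have "0 \<le> (\<Sum>y\<in>A. (N * F y - S)\<^sup>2)"
    by (intro sum_nonneg) simp
  also have "\<dots> = (\<Sum>y\<in>A. N\<^sup>2 * (F y)\<^sup>2 - 2 * N * S * F y + S\<^sup>2)"
    by (intro sum.cong refl) (simp add: power2_eq_square algebra_simps)
  also have "\<dots> = N\<^sup>2 * (\<Sum>y\<in>A. (F y)\<^sup>2) - 2 * N * S * S + N * S\<^sup>2"
    by (simp add: sum.distrib sum_subtractf N_def S_def flip: sum_distrib_left)
  also have "\<dots> = N * (N * (\<Sum>y\<in>A. (F y)\<^sup>2) - S\<^sup>2)"
    by (simp add: power2_eq_square algebra_simps)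
  finally show ?thesis
    using N by (simp add: zero_le_mult_iff N_def S_def)
qed simp

context coprime_form
begin

text \<open>With \<open>p\<close> and \<open>q\<close> the values on the first and on the second elements of the blocks, the equation
  defining the configuration reads \<open>\<Phi> p = \<Phi> q\<close>. So the sum over the configuration is a sum of
  squares over the common value, and Cauchy-Schwarz applies.\<close>

lemma canceling_partition_imp_fully_Sidorenko:
  assumes P: "canceling_partition G d L P"
  shows "fully_Sidorenko G d L"
  unfolding fully_Sidorenko_def
proof
  fix f :: "'a \<Rightarrow> real"
  assume f: "f \<in> carrier G \<rightarrow> {0..1}"
  let ?N = "card (carrier G)"
  have part: "{1..d} = \<Union>P" "disjoint P"
    using P by (auto simp: canceling_partition_def partition_on_def)
  have "\<forall>B\<in>P. \<exists>ij. fst ij \<noteq> snd ij \<and> B = {fst ij, snd ij} \<and> canceling G (L (fst ij)) (L (snd ij))"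
    using P by (force simp: canceling_partition_def)
  then obtain ij where ij: "\<And>B. B \<in> P \<Longrightarrow> fst (ij B) \<noteq> snd (ij B) \<and> B = {fst (ij B), snd (ij B)} \<and>
      canceling G (L (fst (ij B))) (L (snd (ij B)))"
    by metis
  define a b where "a B = fst (ij B)" and "b B = snd (ij B)" for B
  have ab: "a B \<noteq> b B" "B = {a B, b B}" "canceling G (L (a B)) (L (b B))" if "B \<in> P" for B
    using ij[OF that] by (auto simp: a_def b_def)
  have ab_in: "a B \<in> {1..d}" "b B \<in> {1..d}" if "B \<in> P" for B
    using ab(2)[OF that] that part(1) by blast+
  have finP: "finite P"
    using part(1) by (metis finite_UnionD finite_atLeastAtMost)
  have fin_block: "finite B" "card B = 2" if "B \<in> P" for B
    using ab(1,2)[OF that] by (metis finite.emptyI finite.insertI, metis card_2_iff)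
  have d_eq: "d = 2 * card P"
  proof -
    have "card (\<Union>P) = sum card P"
      using part(2) fin_block by (intro card_Union_disjoint) auto
    then show ?thesis
      using fin_block by (simp flip: part(1))
  qed
  define X where "X = P \<rightarrow>\<^sub>E carrier G"
  define V where "V = {1..d} \<rightarrow>\<^sub>E carrier G"
  define \<Phi> where "\<Phi> p = finprod G (\<lambda>B. p B [^] L (a B)) P" for p
  define w where "w p = (\<Prod>B\<in>P. f (p B))" for p
  define fst_of where "fst_of v = (\<lambda>B\<in>P. v (a B))" for v :: "nat \<Rightarrow> 'a"
  define snd_of where "snd_of v = (\<lambda>B\<in>P. v (b B))" for v :: "nat \<Rightarrow> 'a"
  define F where "F y = (\<Sum>p\<in>X. if \<Phi> p = y then w p else 0)" for y
  have finX: "finite X" and finV: "finite V"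
    using finP finite_carrier by (auto simp: X_def V_def intro!: finite_PiE)
  have \<Phi>_closed: "\<Phi> p \<in> carrier G" if "p \<in> X" for p
    unfolding \<Phi>_def using that by (intro finprod_closed) (auto simp: X_def)
  have halves: "fst_of v \<in> X" "snd_of v \<in> X" if "v \<in> V" for v
    using that ab_in by (auto simp: X_def V_def fst_of_def snd_of_def)
  have bij: "bij_betw (\<lambda>v. (fst_of v, snd_of v)) V (X \<times> X)"
  proof (rule bij_betw_imageI)
    show inj: "inj_on (\<lambda>v. (fst_of v, snd_of v)) V"
    proof (rule inj_onI, simp, elim conjE)
      fix v v' assume v: "v \<in> V" "v' \<in> V" and eq: "fst_of v = fst_of v'" "snd_of v = snd_of v'"
      show "v = v'"
      proof (rule PiE_ext[OF v[unfolded V_def]])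
        fix k assume "k \<in> {1..d}"
        then obtain B where B: "B \<in> P" "k \<in> B" using part(1) by blast
        have "v (a B) = v' (a B)" "v (b B) = v' (b B)"
          using fun_cong[OF eq(1), of B] fun_cong[OF eq(2), of B] B(1)
          by (simp_all add: fst_of_def snd_of_def)
        moreover have "k = a B \<or> k = b B" using ab(2)[OF B(1)] B(2) by blast
        ultimately show "v k = v' k" by blast
      qed
    qed
    \<comment> \<open>Surjectivity by counting: the map is injective and both sides have the same
      finite cardinality.\<close>
    have "card V = card (X \<times> X)"
      using finP by (simp add: V_def X_def card_PiE card_cartesian_product d_eq mult_2 power_add)
    then have "card ((\<lambda>v. (fst_of v, snd_of v)) ` V) = card (X \<times> X)"
      using inj by (simp add: card_image)
    then show "(\<lambda>v. (fst_of v, snd_of v)) ` V = X \<times> X"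
      using halves finX by (intro card_subset_eq) auto
  qed
  have eqn: "finprod G (\<lambda>i. v i [^] L i) {1..d} = \<Phi> (fst_of v) \<otimes> inv (\<Phi> (snd_of v))"
    if v: "v \<in> V" for v
  proof -
    have vc: "v i \<in> carrier G" if "i \<in> {1..d}" for i
      using v that by (auto simp: V_def)
    \<comment> \<open>The second element also gets the exponent \<open>L (a B)\<close>: canceling
      makes the power by \<open>L (b B)\<close> the inverse of that by \<open>L (a B)\<close>, so
      one map \<Phi> serves both halves.\<close>
    let ?s = "\<lambda>B. v (b B) [^] L (a B)"
    have pair: "finprod G (\<lambda>i. v i [^] L i) B = v (a B) [^] L (a B) \<otimes> inv (?s B)" if B: "B \<in> P" for B
    proof -
      note c = vc[OF ab_in(1)[OF B]] vc[OF ab_in(2)[OF B]]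
      have "v (b B) [^] L (b B) \<otimes> ?s B = v (b B) [^] (L (a B) + L (b B))"
        using c by (simp add: int_pow_mult m_comm)
      also have "\<dots> = \<one>"
        using ab(3)[OF B] c by (simp add: canceling_def)
      finally have "inv (?s B) = v (b B) [^] L (b B)"
        using c by (simp add: inv_equality)
      then have "finprod G (\<lambda>i. v i [^] L i) {a B, b B} = v (a B) [^] L (a B) \<otimes> inv (?s B)"
        using c ab(1)[OF B] by simp
      then show ?thesis by (simp flip: ab(2)[OF B])
    qed
    have s: "?s \<in> P \<rightarrow> carrier G" "(\<lambda>B. inv (?s B)) \<in> P \<rightarrow> carrier G"
        "(\<lambda>B. v (a B) [^] L (a B)) \<in> P \<rightarrow> carrier G"
      using vc ab_in by auto
    have "finprod G (\<lambda>B. inv (?s B)) P \<otimes> finprod G ?s P = finprod G (\<lambda>B. inv (?s B) \<otimes> ?s B) P"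
      using s by (simp add: finprod_multf)
    also have "\<dots> = \<one>"
      using vc ab_in by (intro finprod_one_eqI) simp
    finally have "finprod G (\<lambda>B. inv (?s B)) P = inv (finprod G ?s P)"
      using s by (metis finprod_closed inv_equality)
    moreover have "\<Phi> (fst_of v) = finprod G (\<lambda>B. v (a B) [^] L (a B)) P" "\<Phi> (snd_of v) = finprod G ?s P"
      unfolding \<Phi>_def using s by (auto intro!: finprod_cong' simp: fst_of_def snd_of_def)
    moreover have "finprod G (\<lambda>i. v i [^] L i) (\<Union>P) = finprod G (finprod G (\<lambda>i. v i [^] L i)) P"
      using finP fin_block(1) vc[unfolded part(1)] part(2) by (intro finprod_Union_disjoint) auto
    moreover have "\<dots> = finprod G (\<lambda>B. v (a B) [^] L (a B) \<otimes> inv (?s B)) P"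
      using pair s by (intro finprod_cong') auto
    moreover have "\<dots> = finprod G (\<lambda>B. v (a B) [^] L (a B)) P \<otimes> finprod G (\<lambda>B. inv (?s B)) P"
      using s by (simp add: finprod_multf)
    ultimately show ?thesis using part(1) by simp
  qed
  have C_iff: "v \<in> C \<longleftrightarrow> \<Phi> (fst_of v) = \<Phi> (snd_of v)" if "v \<in> V" for v
  proof -
    have "v \<in> C \<longleftrightarrow> \<Phi> (fst_of v) \<otimes> inv (\<Phi> (snd_of v)) = \<one>"
      using that eqn[OF that] by (simp add: configuration_def V_def)
    also have "\<dots> \<longleftrightarrow> \<Phi> (fst_of v) = \<Phi> (snd_of v)"
      using \<Phi>_closed halves[OF that] by (metis inv_closed inv_inv inv_equality r_inv)
    finally show ?thesis .
  qed
  have weight_split: "(\<Prod>i=1..d. f (v i)) = w (fst_of v) * w (snd_of v)" for v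
  proof -
    have "(\<Prod>i\<in>\<Union>P. f (v i)) = (\<Prod>B\<in>P. \<Prod>i\<in>B. f (v i))"
      using part(2) fin_block by (subst prod.Union_disjoint) (auto simp: disjoint_def)
    also have "\<dots> = (\<Prod>B\<in>P. f (v (a B)) * f (v (b B)))"
    proof (intro prod.cong refl)
      fix B assume B: "B \<in> P"
      have "(\<Prod>i\<in>{a B, b B}. f (v i)) = f (v (a B)) * f (v (b B))"
        using ab(1)[OF B] by simp
      then show "(\<Prod>i\<in>B. f (v i)) = f (v (a B)) * f (v (b B))"
        by (simp flip: ab(2)[OF B])
    qed
    finally show ?thesis
      unfolding part(1) by (simp add: w_def fst_of_def snd_of_def prod.distrib)
  qed
  have "(\<Sum>v\<in>C. \<Prod>i=1..d. f (v i))
      = (\<Sum>v\<in>V. if \<Phi> (fst_of v) = \<Phi> (snd_of v) then w (fst_of v) * w (snd_of v) else 0)"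
    using finV C_iff weight_split
    by (intro sum.mono_neutral_cong_left) (auto simp: configuration_def V_def)
  also have "\<dots> = (\<Sum>pq\<in>X \<times> X. if \<Phi> (fst pq) = \<Phi> (snd pq) then w (fst pq) * w (snd pq) else 0)"
    by (subst sum.reindex_bij_betw[OF bij, symmetric]) (simp cong: if_cong)
  also have "\<dots> = (\<Sum>p\<in>X. \<Sum>q\<in>X. if \<Phi> p = \<Phi> q then w p * w q else 0)"
    by (simp add: sum.cartesian_product case_prod_beta)
  \<comment> \<open>Summing over the common value \<open>y\<close> of \<Phi> decouples
    \<open>p\<close> from \<open>q\<close>.\<close>
  also have "\<dots> = (\<Sum>p\<in>X. \<Sum>q\<in>X. \<Sum>y\<in>carrier G.
      (if \<Phi> p = y then w p else 0) * (if \<Phi> q = y then w q else 0))"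
  proof (intro sum.cong refl)
    fix p q assume "p \<in> X" "q \<in> X"
    have "(\<Sum>y\<in>carrier G. (if \<Phi> p = y then w p else 0) * (if \<Phi> q = y then w q else 0))
        = (\<Sum>y\<in>carrier G. if y = \<Phi> p then (if \<Phi> p = \<Phi> q then w p * w q else 0) else 0)"
      by (intro sum.cong refl) auto
    also have "\<dots> = (if \<Phi> p = \<Phi> q then w p * w q else 0)"
      using finite_carrier \<Phi>_closed[OF \<open>p \<in> X\<close>] by simp
    finally show "(if \<Phi> p = \<Phi> q then w p * w q else 0) = (\<Sum>y\<in>carrier G.
      (if \<Phi> p = y then w p else 0) * (if \<Phi> q = y then w q else 0))" ..
  qed
  also have "\<dots> = (\<Sum>p\<in>X. \<Sum>y\<in>carrier G. (if \<Phi> p = y then w p else 0) * F y)"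
    unfolding F_def sum_distrib_left by (intro sum.cong refl sum.swap)
  also have "\<dots> = (\<Sum>y\<in>carrier G. (F y)\<^sup>2)"
    unfolding F_def power2_eq_square sum_distrib_right by (rule sum.swap)
  finally have sum_eq: "(\<Sum>v\<in>C. \<Prod>i=1..d. f (v i)) = (\<Sum>y\<in>carrier G. (F y)\<^sup>2)" .
  \<comment> \<open>Each \<open>p\<close> lies over exactly one \<open>y\<close>, so the total of
    \<open>F\<close> is the unrestricted sum of \<open>w\<close>, which is a power of the sum of
    \<open>f\<close>.\<close>
  have "(\<Sum>y\<in>carrier G. F y) = (\<Sum>p\<in>X. \<Sum>y\<in>carrier G. if \<Phi> p = y then w p else 0)"
    unfolding F_def by (rule sum.swap)
  also have "\<dots> = (\<Sum>p\<in>X. w p)"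
    using finite_carrier \<Phi>_closed by (intro sum.cong refl) simp
  also have "\<dots> = (\<Sum>x\<in>carrier G. f x) ^ card P"
    unfolding X_def w_def using finP finite_carrier by (subst prod_sum_PiE[symmetric]) auto
  finally have "(\<Sum>x\<in>carrier G. f x) ^ d = (\<Sum>y\<in>carrier G. F y)\<^sup>2"
    by (simp add: d_eq power_mult mult.commute[of 2])
  also have "\<dots> \<le> real ?N * (\<Sum>v\<in>C. \<Prod>i=1..d. f (v i))"
    unfolding sum_eq using finite_carrier by (rule sum_squared_le_card_mult_sum_squares)
  finally have le: "(\<Sum>x\<in>carrier G. f x) ^ d \<le> real ?N * (\<Sum>v\<in>C. \<Prod>i=1..d. f (v i))" .
  have "expect (carrier G) f ^ d = (\<Sum>x\<in>carrier G. f x) ^ d / (real ?N * real ?N ^ (d - 1))"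
    using d_pos by (cases d) (auto simp: expect_def power_divide)
  also have "\<dots> \<le> real ?N * (\<Sum>v\<in>C. \<Prod>i=1..d. f (v i)) / (real ?N * real ?N ^ (d - 1))"
    using le by (intro divide_right_mono) auto
  also have "\<dots> = arith_mult G d L f"
    using card_carrier_pos by (simp add: arith_mult_eq)
  finally show "expect (carrier G) f ^ d \<le> arith_mult G d L f" .
qed

section \<open>Even number of variables without a canceling partition\<close>

lemma canceling_partition_if_bij_betw:
  assumes "I \<union> J = {1..d}" "I \<inter> J = {}" "bij_betw \<sigma> I J"
    and "\<And>i. i \<in> I \<Longrightarrow> canceling G (L i) (L (\<sigma> i))"
  shows "canceling_partition G d L ((\<lambda>i. {i, \<sigma> i}) ` I)"
proof -
  have \<sigma>: "\<sigma> ` I = J" "inj_on \<sigma> I"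
    using assms(3) by (auto simp: bij_betw_def)
  have "\<Union>((\<lambda>i. {i, \<sigma> i}) ` I) = {1..d}"
    using \<sigma>(1) assms(1) by blast
  moreover have "disjoint ((\<lambda>i. {i, \<sigma> i}) ` I)"
  proof (rule disjointI, clarify)
    fix i j assume "i \<in> I" "j \<in> I" "{i, \<sigma> i} \<noteq> {j, \<sigma> j}"
    then have "i \<noteq> j" "\<sigma> i \<noteq> \<sigma> j" "\<sigma> i \<in> J" "\<sigma> j \<in> J"
      using \<sigma> by (auto simp: inj_on_def)
    then show "{i, \<sigma> i} \<inter> {j, \<sigma> j} = {}"
      using \<open>i \<in> I\<close> \<open>j \<in> I\<close> assms(2) by auto
  qed
  moreover have "i \<noteq> \<sigma> i" if "i \<in> I" for i
    using that \<sigma> assms(2) by blast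
  then have "\<exists>k j. k \<noteq> j \<and> B = {k, j} \<and> canceling G (L k) (L j)" if "B \<in> (\<lambda>i. {i, \<sigma> i}) ` I" for B
    using that assms(4) by blast
  ultimately show ?thesis
    unfolding canceling_partition_def partition_on_def by auto
qed

text \<open>\<open>g\<close> is \<open>h\<close> carried to the powers of \<open>x\<close> and
  extended by zero. Tuples leaving the subgroup contribute nothing, and inside it the equation
  becomes a congruence between exponents modulo \<open>ord x\<close>.\<close>

lemma sum_carrier_transport:
  fixes h :: "nat \<Rightarrow> real"
  assumes x: "x \<in> carrier G"
  obtains g where "(\<Sum>y\<in>carrier G. g y) = (\<Sum>n<ord x. h n)"
    "(\<Sum>v\<in>C. \<Prod>i=1..d. g (v i)) = (\<Sum>v | v \<in> {1..d} \<rightarrow>\<^sub>E {..<ord x} \<and>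
        int (ord x) dvd (\<Sum>i=1..d. L i * int (v i)). \<Prod>i=1..d. h (v i))"
proof -
  let ?e = "ord x"
  have e: "?e > 0" using ord_ge_1[OF finite_carrier x] by simp
  define H where "H = (\<lambda>n. x [^] n) ` {..<?e}"
  \<comment> \<open>The discrete logarithm to base \<open>x\<close>, with values below
    \<open>ord x\<close>.\<close>
  define lg where "lg = inv_into {..<?e} (\<lambda>n. x [^] n)"
  define g where "g y = (if y \<in> H then h (lg y) else 0)" for y
  have "{0..?e - 1} = {..<?e}" using e by auto
  then have inj: "inj_on (\<lambda>n. x [^] n) {..<?e}"
    using ord_inj[OF x] by simp
  have H: "H \<subseteq> carrier G" using x by (auto simp: H_def)
  have lg: "lg (x [^] n) = n" if "n < ?e" for n
    using that inj by (simp add: lg_def inv_into_f_f)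
  have gpow: "g (x [^] n) = h n" if "n < ?e" for n
    using that lg by (auto simp: g_def H_def)
  have lgH: "lg y < ?e" "x [^] lg y = y" if "y \<in> H" for y
    using that lg by (auto simp: H_def)
  show ?thesis
  proof
    have "(\<Sum>y\<in>carrier G. g y) = (\<Sum>y\<in>H. g y)"
      using H finite_carrier by (intro sum.mono_neutral_right) (auto simp: g_def)
    also have "\<dots> = (\<Sum>n<?e. h n)"
      unfolding H_def using inj gpow by (simp add: sum.reindex)
    finally show "(\<Sum>y\<in>carrier G. g y) = (\<Sum>n<ord x. h n)" .
    let ?V = "{v. v \<in> {1..d} \<rightarrow>\<^sub>E {..<ord x} \<and> int (ord x) dvd (\<Sum>i=1..d. L i * int (v i))}"
    let ?ex = "\<lambda>v. \<lambda>i\<in>{1..d}. x [^] (v i :: nat)"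
    let ?lg = "\<lambda>v. \<lambda>i\<in>{1..d}. lg (v i)"
    have ex_C: "?ex v \<in> C \<longleftrightarrow> int ?e dvd (\<Sum>i=1..d. L i * int (v i))" for v
    proof -
      have "finprod G (\<lambda>i. x [^] (L i * int (v i))) A = x [^] (\<Sum>i\<in>A. L i * int (v i))"
        if "finite A" for A
        using that by induction (use x in \<open>auto simp: int_pow_mult\<close>)
      moreover have "finprod G (\<lambda>i. ?ex v i [^] L i) {1..d} = finprod G (\<lambda>i. x [^] (L i * int (v i))) {1..d}"
        using x by (intro finprod_cong') (auto simp: int_pow_pow mult.commute simp flip: int_pow_int)
      ultimately have "finprod G (\<lambda>i. ?ex v i [^] L i) {1..d} = x [^] (\<Sum>i=1..d. L i * int (v i))"
        by simp
      moreover have "?ex v \<in> {1..d} \<rightarrow>\<^sub>E carrier G" using x by auto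
      ultimately show ?thesis
        using x by (simp add: configuration_def int_pow_eq_id)
    qed
    have "(\<Sum>v\<in>C. \<Prod>i=1..d. g (v i)) = (\<Sum>v | v \<in> C \<and> v \<in> {1..d} \<rightarrow>\<^sub>E H. \<Prod>i=1..d. g (v i))"
    proof (rule sum.mono_neutral_right)
      show "\<forall>v\<in>C - {v. v \<in> C \<and> v \<in> {1..d} \<rightarrow>\<^sub>E H}. (\<Prod>i=1..d. g (v i)) = 0"
      proof
        fix v assume "v \<in> C - {v. v \<in> C \<and> v \<in> {1..d} \<rightarrow>\<^sub>E H}"
        then have "\<exists>i\<in>{1..d}. v i \<notin> H"
          by (auto simp: configuration_def PiE_def Pi_def)
        then show "(\<Prod>i=1..d. g (v i)) = 0"
          by (auto intro!: prod_zero simp: g_def)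
      qed
    qed (use finite_configuration in auto)
    also have "\<dots> = (\<Sum>v\<in>?V. \<Prod>i=1..d. h (v i))"
    proof (rule sum.reindex_bij_witness[where i = ?ex and j = ?lg])
      fix v assume v: "v \<in> {v. v \<in> C \<and> v \<in> {1..d} \<rightarrow>\<^sub>E H}"
      then have vH: "v i \<in> H" if "i \<in> {1..d}" for i using that by auto
      show *: "?ex (?lg v) = v"
        using v lgH(2) vH by (auto simp: fun_eq_iff PiE_def extensional_def)
      have "int ?e dvd (\<Sum>i=1..d. L i * int (?lg v i))"
        using ex_C[of "?lg v"] v unfolding * by simp
      then show "?lg v \<in> ?V"
        using vH lgH(1) by auto
      show "(\<Prod>i=1..d. h (?lg v i)) = (\<Prod>i=1..d. g (v i))"
        using vH by (intro prod.cong refl) (simp add: g_def)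
    next
      fix v assume v: "v \<in> ?V"
      then have ve: "v i < ?e" if "i \<in> {1..d}" for i using that by auto
      show "?lg (?ex v) = v"
        using v lg ve by (auto simp: fun_eq_iff PiE_def extensional_def)
      show "?ex v \<in> {v. v \<in> C \<and> v \<in> {1..d} \<rightarrow>\<^sub>E H}"
        using v ex_C[of v] ve by (auto simp: H_def)
    qed
    finally show "(\<Sum>v\<in>C. \<Prod>i=1..d. g (v i)) = (\<Sum>v\<in>?V. \<Prod>i=1..d. h (v i))" .
  qed
qed

text \<open>If some frequency vanished modulo \<open>b ^ e\<close>, the residues of the
  \<open>c * L i\<close> could be matched as \<open>t\<close> and \<open>e - t\<close>, and removing
  the unit \<open>c\<close> would give a canceling partition.\<close>

lemma even_imp_not_fully_common:
  assumes "even d" and no_part: "\<And>P. \<not> canceling_partition G d L P"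
  shows "\<not> fully_common G d L"
proof -
  obtain x where x: "x \<in> carrier G" and exponent: "\<And>y. y \<in> carrier G \<Longrightarrow> ord y dvd ord x"
    using exists_exponent_element[OF finite_carrier] by blast
  define e where "e = ord x"
  have e: "e > 0" using ord_ge_1[OF finite_carrier x] by (simp add: e_def)
  \<comment> \<open>Here it matters that \<open>e\<close> is the exponent: a congruence modulo
    \<open>e\<close> cancels in all of \<open>G\<close>, not only on the powers of
    \<open>x\<close>.\<close>
  have cancel: "canceling G m n" if "int e dvd m + n" for m n
    unfolding canceling_def
  proof
    fix y assume y: "y \<in> carrier G"
    then have "int (ord y) dvd m + n"
      using exponent[OF y] that by (metis e_def dvd_trans int_dvd_int_iff)
    with y show "y [^] (m + n) = \<one>" by (simp add: int_pow_eq_id)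
  qed
  have cop: "coprime (L i) (int e)" if "i \<in> {1..d}" for i
    using coprime_order[OF that] ord_dvd_group_order[OF x]
    by (metis coprime_divisors dvd_refl e_def int_dvd_int_iff)
  \<comment> \<open>For \<open>e \<le> 2\<close> any two coefficients cancel, both being odd if
    \<open>e = 2\<close>; as \<open>d\<close> is even, pairing consecutive indices would be a
    canceling partition.\<close>
  have e3: "e \<ge> 3"
  proof (rule ccontr)
    assume "\<not> e \<ge> 3"
    with e have e12: "e = 1 \<or> e = 2" by auto
    let ?I = "{i \<in> {1..d}. odd i}" and ?J = "{i \<in> {1..d}. even i}"
    have "canceling_partition G d L ((\<lambda>i. {i, Suc i}) ` ?I)"
    proof (rule canceling_partition_if_bij_betw)
      show "bij_betw Suc ?I ?J"
      proof (rule bij_betw_byWitness[where f' = "\<lambda>n. n - 1"])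
        show "Suc ` ?I \<subseteq> ?J"
        proof clarsimp
          fix i assume "i \<le> d" "odd i"
          then have "i \<noteq> d" using \<open>even d\<close> by auto
          with \<open>i \<le> d\<close> show "Suc i \<le> d" by simp
        qed
        show "(\<lambda>n. n - 1) ` ?J \<subseteq> ?I"
        proof clarsimp
          fix n assume "Suc 0 \<le> n" "n \<le> d" "even n"
          then show "Suc 0 \<le> n - Suc 0 \<and> n - Suc 0 \<le> d" by (cases n) (auto intro!: Suc_leI gr0I)
        qed
      qed auto
      fix i assume i: "i \<in> ?I"
      then have "i < d" using \<open>even d\<close> by (auto simp: less_le)
      then have "coprime (L i) (int e)" "coprime (L (Suc i)) (int e)"
        using i by (auto intro!: cop)
      then show "canceling G (L i) (L (Suc i))"
        using e12 by (intro cancel) auto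
    qed auto
    with no_part show False by blast
  qed
  \<comment> \<open>The base exceeds the number \<open>d\<close> of summands, so the digits of a sum
    of weights cannot carry.\<close>
  define b where "b = d + 1"
  have no_dvd: "\<not> int b ^ e dvd (\<Sum>i=1..d. weight e (int b) (nat (int c * L i mod int e)))"
    if c: "coprime c e" for c
  proof
    assume dvd: "int b ^ e dvd (\<Sum>i=1..d. weight e (int b) (nat (int c * L i mod int e)))"
    define r where "r i = nat (int c * L i mod int e)" for i
    have r_int: "int (r i) = int c * L i mod int e" for i
      using e by (simp add: r_def)
    have r_less: "r i < e" for i
      using e by (simp add: r_def nat_less_iff)
    \<comment> \<open>The matching would miss the residue \<open>e / 2\<close>; it is a unit modulo
      \<open>e\<close> only for \<open>e = 2\<close>.\<close>
    have r_half: "2 * r i \<noteq> e" if "i \<in> {1..d}" for i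
    proof
      assume half: "2 * r i = e"
      have "coprime (int c * L i) (int e)"
        using c cop[OF that] by simp
      then have "coprime (int (r i)) (int e)"
        using e by (simp add: r_int)
      then have "coprime (r i) e" by simp
      moreover have "r i dvd e" using half by (metis dvd_triv_right)
      ultimately have "r i = 1" by (simp add: coprime_absorb_left)
      with half e3 show False by simp
    qed
    have "card {i \<in> {1..d}. r i = t} = card {i \<in> {1..d}. r i + t = e}" if "2 * t < e" for t
      using dvd that by (intro weight_sum_dvd_imp_card_eq[where b = "int b"]) (auto simp: b_def r_def)
    then obtain \<sigma> where
      \<sigma>: "bij_betw \<sigma> {i \<in> {1..d}. 2 * r i < e} {i \<in> {1..d}. 2 * r i > e \<and> r i \<le> e}"
        "\<And>i. i \<in> {1..d} \<Longrightarrow> 2 * r i < e \<Longrightarrow> r i + r (\<sigma> i) = e"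
      using exists_symmetric_matching[of "{1..d}" e r] by auto
    have "canceling_partition G d L ((\<lambda>i. {i, \<sigma> i}) ` {i \<in> {1..d}. 2 * r i < e})"
    proof (rule canceling_partition_if_bij_betw[OF _ _ \<sigma>(1)])
      show "{i \<in> {1..d}. 2 * r i < e} \<union> {i \<in> {1..d}. 2 * r i > e \<and> r i \<le> e} = {1..d}"
        using r_half r_less by (auto simp: less_imp_le) (meson linorder_neqE_nat)
      fix i assume i: "i \<in> {i \<in> {1..d}. 2 * r i < e}"
      then have "int (r i) + int (r (\<sigma> i)) = int e"
        using \<sigma>(2)[of i] by (auto simp flip: of_nat_add)
      then have "(int c * L i mod int e + int c * L (\<sigma> i) mod int e) mod int e = 0"
        by (simp add: r_int)
      then have "int e dvd int c * (L i + L (\<sigma> i))"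
        by (simp add: mod_add_eq ring_distribs dvd_eq_mod_eq_0)
      then have "int e dvd L i + L (\<sigma> i)"
        using c by (simp add: coprime_commute coprime_dvd_mult_right_iff)
      then show "canceling G (L i) (L (\<sigma> i))" by (rule cancel)
    qed auto
    with no_part show False by blast
  qed
  obtain h :: "nat \<Rightarrow> real" where h: "(\<Sum>n<e. h n) = 0"
    "(\<Sum>v | v \<in> {1..d} \<rightarrow>\<^sub>E {..<e} \<and> int e dvd (\<Sum>i=1..d. L i * int (v i)). \<Prod>i=1..d. h (v i)) < 0"
    by (rule exists_negative_on_cyclic[of e "{1..d}" L b]) (use e3 d_pos cop no_dvd in \<open>auto simp: b_def\<close>)
  obtain g where g: "(\<Sum>y\<in>carrier G. g y) = (\<Sum>n<e. h n)"
    "(\<Sum>v\<in>C. \<Prod>i=1..d. g (v i)) = (\<Sum>v | v \<in> {1..d} \<rightarrow>\<^sub>E {..<e} \<and>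
        int e dvd (\<Sum>i=1..d. L i * int (v i)). \<Prod>i=1..d. h (v i))"
    unfolding e_def by (rule sum_carrier_transport[OF x])
  show ?thesis
  proof (rule not_fully_common[OF \<open>even d\<close>])
    show "(\<Sum>y\<in>carrier G. g y) = 0" using g h by simp
    show "arith_mult G d L g < 0"
      using g(2) h(2) card_carrier_pos by (simp add: arith_mult_eq divide_neg_pos)
  qed
qed

end

theorem theorem1p4:
  fixes G :: "('a, 'b) monoid_scheme" and d :: nat and L :: "nat \<Rightarrow> int"
  assumes "comm_group G" and "finite (carrier G)"
    and "d \<ge> 1"
    and "\<And>i. i \<in> {1..d} \<Longrightarrow> coprime (L i) (int (order G))"
  shows "(even d \<and> (\<exists>P. canceling_partition G d L P) \<longrightarrow> fully_Sidorenko G d L) \<and>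
    (odd d \<longrightarrow> fully_common G d L) \<and>
    (odd d \<and> order G > 1 \<longrightarrow> \<not> fully_Sidorenko G d L) \<and>
    (even d \<and> \<not> (\<exists>P. canceling_partition G d L P) \<longrightarrow>
      \<not> fully_common G d L \<and> \<not> fully_Sidorenko G d L)"
proof -
  interpret coprime_form G d L
    using assms by (simp add: coprime_form_def coprime_form_axioms_def)
  show ?thesis
    using canceling_partition_imp_fully_Sidorenko odd_imp_fully_common odd_imp_not_fully_Sidorenko
      even_imp_not_fully_common fully_Sidorenko_imp_fully_common by blast
qed

end
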